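(* Let $X$ be a real Banach space. Then $X$ is isomorphic to a Hilbert space if and only if $X$ has Stampacchia's property (S), that is, if and only if there exists a bounded bilinear form $a:X\times X\to\mathbb{R}$ such that for every nonempty, closed, convex subset $M$ of $X$ and every $x^\ast\in X^\ast$ there exists a unique $x\in M$ with $$a(x,z-x)\geq \langle x^\ast,z-x\rangle\quad\text{for all } z\in M.$$
   Context: $X^\ast$ denotes the (topological) dual of $X$ and $\langle\cdot,\cdot\rangle$ the duality product between $X^\ast$ and $X$, i.e. $\langle x^\ast,x\rangle=x^\ast(x)$. "Isomorphic" means linearly homeomorphic (there is a bounded linear bijection with bounded inverse). Hilbert spaces are real. *)

theory Defs
  imports "HOL-Analysis.Analysis" "HOL-Algebra.Module"
begin

section \<open>Hilbert spaces with an explicit carrier\<close>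

text \<open>
  The statement quantifies existentially over Hilbert spaces inside a formula, so these cannot be
  types of class \<open>real_inner\<close>; they are modules over the field of reals on a carrier set,
  together with an inner product. The components \<open>mult\<close> and \<open>one\<close>, inherited by every
  module record, play no role.
\<close>

definition real_field_ring :: "real ring"
  where "real_field_ring = \<lparr>carrier = UNIV, mult = (*), one = 1, zero = 0, add = (+)\<rparr>"

record 'b inner_module = "(real, 'b) module" +
  iprod :: "'b \<Rightarrow> 'b \<Rightarrow> real"

locale real_inner_product_space = module real_field_ring H for H (structure) +
  assumes iprod_commute:
      "\<lbrakk>x \<in> carrier H; y \<in> carrier H\<rbrakk> \<Longrightarrow> iprod H x y = iprod H y x"
    and iprod_add_left:
      "\<lbrakk>x \<in> carrier H; y \<in> carrier H; z \<in> carrier H\<rbrakk>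
        \<Longrightarrow> iprod H (x \<oplus>\<^bsub>H\<^esub> y) z = iprod H x z + iprod H y z"
    and iprod_smult_left:
      "\<lbrakk>x \<in> carrier H; y \<in> carrier H\<rbrakk> \<Longrightarrow> iprod H (r \<odot>\<^bsub>H\<^esub> x) y = r * iprod H x y"
    and iprod_nonneg: "x \<in> carrier H \<Longrightarrow> iprod H x x \<ge> 0"
    and iprod_eq_zero_iff: "x \<in> carrier H \<Longrightarrow> iprod H x x = 0 \<longleftrightarrow> x = \<zero>\<^bsub>H\<^esub>"

definition iprod_norm :: "('b, 'c) inner_module_scheme \<Rightarrow> 'b \<Rightarrow> real"
  where "iprod_norm H x = sqrt (iprod H x x)"

text \<open>
  The value outside the carrier is irrelevant; it is fixed because \<open>Metric_space\<close> demands
  symmetry and nonnegativity of the distance on the whole type.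
\<close>

definition iprod_dist :: "('b, 'c) inner_module_scheme \<Rightarrow> 'b \<Rightarrow> 'b \<Rightarrow> real"
  where "iprod_dist H x y =
    (if x \<in> carrier H \<and> y \<in> carrier H then iprod_norm H (x \<ominus>\<^bsub>H\<^esub> y) else 0)"

locale real_hilbert_space = real_inner_product_space +
  assumes complete: "Metric_space.mcomplete (carrier H) (iprod_dist H)"


section \<open>Linear homeomorphisms onto a Hilbert space\<close>

definition linear_homeomorphism ::
    "('a::real_normed_vector \<Rightarrow> 'b) \<Rightarrow> ('b, 'c) inner_module_scheme \<Rightarrow> bool"
  where "linear_homeomorphism T H \<longleftrightarrow>
    bij_betw T UNIV (carrier H) \<and>
    (\<forall>x y. T (x + y) = T x \<oplus>\<^bsub>H\<^esub> T y) \<and>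
    (\<forall>r x. T (r *\<^sub>R x) = r \<odot>\<^bsub>H\<^esub> T x) \<and>
    (\<exists>C. \<forall>x. iprod_norm H (T x) \<le> C * norm x) \<and>
    (\<exists>C. \<forall>y\<in>carrier H. norm (inv_into UNIV T y) \<le> C * iprod_norm H y)"

text \<open>
  Taking the carrier of the Hilbert space inside the type of the given space is no restriction:
  a Hilbert space isomorphic to it on any other type can be transported along the bijection, see
  \<open>isomorphic_to_hilbert_spaceI\<close> below.
\<close>

definition isomorphic_to_hilbert_space :: "'a::real_normed_vector itself \<Rightarrow> bool"
  where "isomorphic_to_hilbert_space _ \<longleftrightarrow>
    (\<exists>(H :: 'a inner_module) (T :: 'a \<Rightarrow> 'a). real_hilbert_space H \<and> linear_homeomorphism T H)"


section \<open>Stampacchia's property (S)\<close>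

definition stampacchia_property :: "'a::real_normed_vector itself \<Rightarrow> bool"
  where "stampacchia_property _ \<longleftrightarrow>
    (\<exists>a :: 'a \<Rightarrow> 'a \<Rightarrow> real. bounded_bilinear a \<and>
      (\<forall>(M :: 'a set) (x' :: 'a \<Rightarrow>\<^sub>L real). M \<noteq> {} \<and> closed M \<and> convex M \<longrightarrow>
        (\<exists>!x. x \<in> M \<and> (\<forall>z\<in>M. a x (z - x) \<ge> blinfun_apply x' (z - x)))))"


section \<open>Adequacy of the definitions\<close>

lemma cring_real_field_ring: "cring real_field_ring"
proof (rule cringI)
  show "abelian_group real_field_ring"
    by (rule abelian_groupI) (auto simp: real_field_ring_def intro: exI[of _ "- x" for x :: real])
  show "comm_monoid real_field_ring"
    by (rule comm_monoidI) (auto simp: real_field_ring_def)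
qed (auto simp: real_field_ring_def algebra_simps)

context real_inner_product_space
begin

lemma smult_in_carrier [simp]: "x \<in> carrier H \<Longrightarrow> r \<odot>\<^bsub>H\<^esub> x \<in> carrier H"
  using smult_closed[of r x] by (simp add: real_field_ring_def)

lemma smult_minus_one: "x \<in> carrier H \<Longrightarrow> (- 1) \<odot>\<^bsub>H\<^esub> x = \<ominus>\<^bsub>H\<^esub> x"
proof -
  assume x: "x \<in> carrier H"
  have "(1 + (- 1)) \<odot>\<^bsub>H\<^esub> x = 1 \<odot>\<^bsub>H\<^esub> x \<oplus>\<^bsub>H\<^esub> (- 1) \<odot>\<^bsub>H\<^esub> x"
    using smult_l_distr[of 1 "- 1" x] x by (simp add: real_field_ring_def)
  moreover have "0 \<odot>\<^bsub>H\<^esub> x = \<zero>\<^bsub>H\<^esub>"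
    using smult_l_null[OF x] by (simp add: real_field_ring_def)
  moreover have "1 \<odot>\<^bsub>H\<^esub> x = x"
    using smult_one[OF x] by (simp add: real_field_ring_def)
  ultimately have "x \<oplus>\<^bsub>H\<^esub> (- 1) \<odot>\<^bsub>H\<^esub> x = \<zero>\<^bsub>H\<^esub>" by simp
  then show ?thesis
    using x by (metis M.add.inv_equality M.add.m_comm smult_in_carrier)
qed

lemma minus_eq_smult: 
  "\<lbrakk>x \<in> carrier H; y \<in> carrier H\<rbrakk> \<Longrightarrow> x \<ominus>\<^bsub>H\<^esub> y = x \<oplus>\<^bsub>H\<^esub> (- 1) \<odot>\<^bsub>H\<^esub> y"
  by (simp add: a_minus_def smult_minus_one)

lemma iprod_add_right:
  "\<lbrakk>x \<in> carrier H; y \<in> carrier H; z \<in> carrier H\<rbrakk>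
    \<Longrightarrow> iprod H z (x \<oplus>\<^bsub>H\<^esub> y) = iprod H z x + iprod H z y"
  by (metis M.add.m_closed iprod_add_left iprod_commute)

lemma iprod_smult_right:
  "\<lbrakk>x \<in> carrier H; y \<in> carrier H\<rbrakk> \<Longrightarrow> iprod H y (r \<odot>\<^bsub>H\<^esub> x) = r * iprod H y x"
  by (metis iprod_smult_left iprod_commute smult_in_carrier)

lemma iprod_quadratic:
  assumes "x \<in> carrier H" "y \<in> carrier H"
  shows "iprod H (x \<oplus>\<^bsub>H\<^esub> r \<odot>\<^bsub>H\<^esub> y) (x \<oplus>\<^bsub>H\<^esub> r \<odot>\<^bsub>H\<^esub> y) =
    iprod H x x + 2 * r * iprod H x y + r\<^sup>2 * iprod H y y"
  using assms iprod_commute[OF assms]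
  by (simp add: iprod_add_left iprod_add_right iprod_smult_left iprod_smult_right
      power2_eq_square algebra_simps)

lemma Cauchy_Schwarz:
  assumes "x \<in> carrier H" "y \<in> carrier H"
  shows "(iprod H x y)\<^sup>2 \<le> iprod H x x * iprod H y y"
proof (cases "iprod H y y = 0")
  case True
  then have "y = 0 \<odot>\<^bsub>H\<^esub> y"
    using assms iprod_eq_zero_iff smult_l_null[of y] by (simp add: real_field_ring_def)
  then have "iprod H x y = 0 * iprod H x y"
    using assms iprod_smult_right by metis
  then show ?thesis using True by simp
next
  case False
  then have pos: "iprod H y y > 0" using iprod_nonneg[OF assms(2)] by simp
  define r where "r = - iprod H x y / iprod H y y"
  have "0 \<le> iprod H x x + 2 * r * iprod H x y + r\<^sup>2 * iprod H y y"
    using iprod_quadratic[OF assms, of r] iprod_nonneg assms by (metis M.add.m_closed smult_in_carrier)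
  also have "\<dots> = iprod H x x - (iprod H x y)\<^sup>2 / iprod H y y"
    using pos by (simp add: r_def field_simps power2_eq_square)
  finally show ?thesis using pos by (simp add: field_simps)
qed

lemma iprod_norm_triangle:
  assumes "x \<in> carrier H" "y \<in> carrier H"
  shows "iprod_norm H (x \<oplus>\<^bsub>H\<^esub> y) \<le> iprod_norm H x + iprod_norm H y"
proof -
  have "1 \<odot>\<^bsub>H\<^esub> y = y"
    using smult_one[OF assms(2)] by (simp add: real_field_ring_def)
  then have "iprod H (x \<oplus>\<^bsub>H\<^esub> y) (x \<oplus>\<^bsub>H\<^esub> y) = iprod H x x + 2 * iprod H x y + iprod H y y"
    using iprod_quadratic[OF assms, of 1] by simp
  moreover have "iprod H x y \<le> iprod_norm H x * iprod_norm H y"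
    using Cauchy_Schwarz[OF assms] unfolding iprod_norm_def
    by (metis real_le_rsqrt real_sqrt_mult)
  ultimately have "iprod H (x \<oplus>\<^bsub>H\<^esub> y) (x \<oplus>\<^bsub>H\<^esub> y) \<le> (iprod_norm H x + iprod_norm H y)\<^sup>2"
    using assms by (simp add: power2_sum iprod_norm_def iprod_nonneg)
  moreover have "iprod_norm H x + iprod_norm H y \<ge> 0"
    using assms by (simp add: iprod_norm_def iprod_nonneg)
  ultimately show ?thesis
    unfolding iprod_norm_def[of H "x \<oplus>\<^bsub>H\<^esub> y"] by (simp add: real_le_lsqrt)
qed

lemma Metric_space_iprod_dist: "Metric_space (carrier H) (iprod_dist H)"
proof
  fix x y
  show "0 \<le> iprod_dist H x y"
    by (simp add: iprod_dist_def iprod_norm_def iprod_nonneg)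
  have sq: "iprod H (x \<ominus>\<^bsub>H\<^esub> y) (x \<ominus>\<^bsub>H\<^esub> y) = iprod H x x - 2 * iprod H x y + iprod H y y"
    if "x \<in> carrier H" "y \<in> carrier H" for x y
    using iprod_quadratic[OF that, of "- 1"] that by (simp add: minus_eq_smult)
  show "iprod_dist H x y = iprod_dist H y x"
    using sq[of x y] sq[of y x] iprod_commute[of x y]
    by (simp add: iprod_dist_def iprod_norm_def)
next
  fix x y assume xy: "x \<in> carrier H" "y \<in> carrier H"
  then have "(x \<ominus>\<^bsub>H\<^esub> y) \<oplus>\<^bsub>H\<^esub> y = x"
    by (simp add: a_minus_def M.add.m_assoc M.l_neg)
  then have "x \<ominus>\<^bsub>H\<^esub> y = \<zero>\<^bsub>H\<^esub> \<longleftrightarrow> x = y"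
    using xy by (metis M.l_zero M.r_neg a_minus_def)
  with xy show "iprod_dist H x y = 0 \<longleftrightarrow> x = y"
    by (simp add: iprod_dist_def iprod_norm_def iprod_eq_zero_iff)
next
  fix x y z assume xyz: "x \<in> carrier H" "y \<in> carrier H" "z \<in> carrier H"
  have "x \<ominus>\<^bsub>H\<^esub> z = (x \<ominus>\<^bsub>H\<^esub> y) \<oplus>\<^bsub>H\<^esub> (y \<ominus>\<^bsub>H\<^esub> z)"
    using xyz by (simp add: a_minus_def M.add.m_assoc M.r_neg1)
  then show "iprod_dist H x z \<le> iprod_dist H x y + iprod_dist H y z"
    using iprod_norm_triangle[of "x \<ominus>\<^bsub>H\<^esub> y" "y \<ominus>\<^bsub>H\<^esub> z"] xyz
    by (simp add: iprod_dist_def)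
qed

end

sublocale real_inner_product_space \<subseteq> IP: Metric_space "carrier H" "iprod_dist H"
  by (rule Metric_space_iprod_dist)

definition type_inner_module :: "('a::real_vector \<Rightarrow> 'a \<Rightarrow> real) \<Rightarrow> 'a inner_module"
  where "type_inner_module p =
    \<lparr>carrier = UNIV, mult = (\<lambda>x y. undefined), one = undefined, zero = 0, add = (+),
     smult = (*\<^sub>R), iprod = p\<rparr>"

lemma type_inner_module_simps [simp]:
  "carrier (type_inner_module p) = UNIV"
  "zero (type_inner_module p) = 0"
  "add (type_inner_module p) = (+)"
  "smult (type_inner_module p) = (*\<^sub>R)"
  "iprod (type_inner_module p) = p"
  by (simp_all add: type_inner_module_def)

lemma module_type_inner_module: "module real_field_ring (type_inner_module p)"
proof (rule moduleI)
  show "abelian_group (type_inner_module p)"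
  proof (rule abelian_groupI)
    fix x :: 'a
    show "\<exists>y\<in>carrier (type_inner_module p). y \<oplus>\<^bsub>type_inner_module p\<^esub> x = \<zero>\<^bsub>type_inner_module p\<^esub>"
      by (auto intro: exI[of _ "- x"])
  qed auto
qed (use cring_real_field_ring in
    \<open>auto simp: real_field_ring_def scaleR_left_distrib scaleR_right_distrib\<close>)

lemma a_minus_type_inner_module [simp]: "x \<ominus>\<^bsub>type_inner_module p\<^esub> y = x - y"
proof -
  interpret M: module real_field_ring "type_inner_module p"
    by (rule module_type_inner_module)
  have "\<ominus>\<^bsub>type_inner_module p\<^esub> y = - y"
    using M.M.minus_equality[of "- y" y] by simp
  then show ?thesis by (simp add: a_minus_def)
qed

lemma real_hilbert_space_type_class:
  "real_hilbert_space (type_inner_module (inner :: 'h::{real_inner,complete_space} \<Rightarrow> _))"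
proof -
  let ?H = "type_inner_module (inner :: 'h \<Rightarrow> _)"
  have d: "iprod_dist ?H = dist"
    by (auto simp: fun_eq_iff iprod_dist_def iprod_norm_def dist_norm norm_eq_sqrt_inner)
  show ?thesis
  proof (intro real_hilbert_space.intro real_inner_product_space.intro
      real_hilbert_space_axioms.intro real_inner_product_space_axioms.intro
      module_type_inner_module)
    show "Metric_space.mcomplete (carrier ?H) (iprod_dist ?H)"
      using complete_UNIV unfolding d by simp
  qed (auto simp: inner_left_distrib inner_right_distrib inner_commute)
qed

text \<open>The carrier of the Hilbert space may live on any type.\<close>

lemma isomorphic_to_hilbert_spaceI:
  fixes T :: "'a::real_normed_vector \<Rightarrow> 'b" and H :: "('b, 'c) inner_module_scheme"
  assumes "real_hilbert_space H" and T: "linear_homeomorphism T H"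
  shows "isomorphic_to_hilbert_space TYPE('a)"
proof -
  interpret H: real_hilbert_space H by fact
  define p where "p = (\<lambda>x y. iprod H (T x) (T y))"
  let ?K = "type_inner_module p"
  have bij: "bij_betw T UNIV (carrier H)"
    and add: "\<And>x y. T (x + y) = T x \<oplus>\<^bsub>H\<^esub> T y"
    and scale: "\<And>r x. T (r *\<^sub>R x) = r \<odot>\<^bsub>H\<^esub> T x"
    using T by (auto simp: linear_homeomorphism_def)
  have inj: "inj T" and car [simp]: "T x \<in> carrier H" for x
    using bij by (auto simp: bij_betw_def)
  have T0: "T 0 = \<zero>\<^bsub>H\<^esub>"
    using scale[of 0 0] H.smult_l_null[of "T 0"] by (simp add: real_field_ring_def)
  have diff: "T (x - y) = T x \<ominus>\<^bsub>H\<^esub> T y" for x y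
    using add[of x "- y"] scale[of "- 1" y] by (simp add: H.minus_eq_smult)
  have norm_K: "iprod_norm ?K x = iprod_norm H (T x)" for x
    by (simp add: iprod_norm_def p_def)
  have dist_K: "iprod_dist ?K x y = iprod_dist H (T x) (T y)" for x y
    by (simp add: iprod_dist_def norm_K diff)
  have ip: "real_inner_product_space ?K"
  proof (intro real_inner_product_space.intro real_inner_product_space_axioms.intro
      module_type_inner_module)
    fix x show "iprod ?K x x = 0 \<longleftrightarrow> x = \<zero>\<^bsub>?K\<^esub>"
      using inj T0 by (auto simp: p_def H.iprod_eq_zero_iff inj_def)
  qed (auto simp: p_def add scale H.iprod_add_left H.iprod_smult_left H.iprod_nonneg
      intro: H.iprod_commute)
  interpret K: real_inner_product_space ?K by (rule ip)
  have "K.IP.mcomplete"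
    unfolding K.IP.mcomplete_def
  proof (intro allI impI)
    fix s assume "K.IP.MCauchy s"
    then have "H.IP.MCauchy (T \<circ> s)"
      unfolding K.IP.MCauchy_def H.IP.MCauchy_def by (auto simp: dist_K)
    then obtain y where y: "limitin H.IP.mtopology (T \<circ> s) y sequentially"
      using H.complete H.IP.mcomplete_def by blast
    then have "y \<in> carrier H" by (rule H.IP.limitin_mspace)
    then obtain x where "y = T x" using bij by (auto simp: bij_betw_def)
    with y have "limitin K.IP.mtopology s x sequentially"
      unfolding K.IP.limit_metric_sequentially H.IP.limit_metric_sequentially
      by (simp add: dist_K)
    then show "\<exists>x. limitin K.IP.mtopology s x sequentially" ..
  qed
  then have "real_hilbert_space ?K"
    by (intro real_hilbert_space.intro real_hilbert_space_axioms.intro ip)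
  moreover have "linear_homeomorphism id ?K"
  proof -
    obtain C where "\<forall>y\<in>carrier H. norm (inv_into UNIV T y) \<le> C * iprod_norm H y"
      using T by (auto simp: linear_homeomorphism_def)
    then have "norm x \<le> C * iprod_norm H (T x)" for x
      using inv_into_f_f[of T UNIV x] inj car[of x] by (metis UNIV_I)
    then show ?thesis
      using T unfolding linear_homeomorphism_def by (auto simp: norm_K inv_into_f_f)
  qed
  ultimately show ?thesis
    unfolding isomorphic_to_hilbert_space_def by blast
qed

corollary isomorphic_to_hilbert_space_type_class:
  fixes T :: "'a::real_normed_vector \<Rightarrow> 'h::{real_inner,complete_space}"
  assumes "bounded_linear T" "bij T" "bounded_linear (inv_into UNIV T)"
  shows "isomorphic_to_hilbert_space TYPE('a)"
proof (rule isomorphic_to_hilbert_spaceI[OF real_hilbert_space_type_class])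
  show "linear_homeomorphism T (type_inner_module (inner :: 'h \<Rightarrow> _))"
    using assms bounded_linear.bounded[OF assms(1)] bounded_linear.bounded[OF assms(3)]
    by (auto simp: linear_homeomorphism_def iprod_norm_def mult.commute
        linear_add[OF bounded_linear.linear] linear_scale[OF bounded_linear.linear]
        simp flip: norm_eq_sqrt_inner)
qed

end

theory Submission
  imports Defs
begin

text \<open>
  Both properties of \<open>X\<close> are equivalent to the existence of a bounded bilinear form that is coercive,
  \<open>a x x \<ge> c * (norm x)\<^sup>2\<close> with \<open>c > 0\<close>.

  For Hilbert spaces this is clear: the inner product, pulled back to \<open>X\<close>, is such a form, and
  conversely the symmetric part of a coercive form is an inner product whose norm is equivalent to
  that of \<open>X\<close>, hence complete. If \<open>p\<close> is coercive and symmetric, the variational inequality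
  \<open>p x (z - x) \<ge> x' (z - x)\<close> on \<open>M\<close> is the optimality condition of the strongly convex problem of
  minimising \<open>p z z / 2 - x' z\<close> over \<open>M\<close>, so it has exactly one solution
  (\<open>symmetric_coercive_variational_inequality\<close>).

  The substance is the converse: a form \<open>a\<close> for which all variational inequalities are uniquely
  solvable is coercive (\<open>stampacchia_form.coercive\<close>). The choice of \<open>M\<close> is free,
  and three choices suffice. Segments show that
  \<open>a x x > 0\<close> for \<open>x \<noteq> 0\<close> (\<open>diagonal_pos\<close>). The unit ball yields, for each unit vector \<open>x\<close>, a
  functional of norm at most 2 with value 1 at \<open>x\<close> (\<open>unit_vector_functional\<close>), which replaces the
  Hahn-Banach theorem. On a closed subspace \<open>V\<close> the inequality becomes an equation: every functional
  on \<open>V\<close> that is the restriction of some \<open>x'\<close> has the form \<open>a w\<close> with \<open>w \<in> V\<close>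
  (\<open>solution_on_closed_subspace\<close>). The last fact is contradicted by a gliding hump if \<open>a\<close> is not
  coercive. Failure of coercivity persists on every closed subspace of finite codimension
  (\<open>coercive_on_finite_kernel_imp_coercive\<close>), so one finds unit vectors \<open>x 0, x 1, \<dots>\<close> that are mutually
  orthogonal for \<open>a\<close>, with \<open>a (x n) (x n)\<close> as small as desired, and functionals \<open>f n\<close> of norm at
  most 2 that are triangular with respect to them (\<open>obtain_orthogonal_sequence\<close>). Triangularity
  bounds the coordinates of any \<open>w\<close> in the closed span \<open>V\<close> by \<open>2 * 3^n * norm w\<close>, whence
  \<open>a w (x n) \<le> 2 * 3^n * norm w * a (x n) (x n)\<close>. The functional \<open>x' = (\<Sum>n. (1/5)^n *\<^sub>R f n)\<close>
  has \<open>x' (x n) \<ge> (1/5)^n / 2\<close>, so with \<open>a (x n) (x n) < (1/16)^n\<close> no \<open>w \<in> V\<close> can represent it.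
\<close>

definition coercive_on :: "'a::real_normed_vector set \<Rightarrow> ('a \<Rightarrow> 'a \<Rightarrow> real) \<Rightarrow> bool"
  where "coercive_on W a \<longleftrightarrow> (\<exists>c>0. \<forall>x\<in>W. c * (norm x)\<^sup>2 \<le> a x x)"

section \<open>Variational inequalities for symmetric coercive forms\<close>

text \<open>
  Direct method: by the parallelogram law a minimising sequence of \<open>p z z / 2 - x' z\<close> on \<open>M\<close> is
  Cauchy, and the derivative of this function at \<open>x\<close> in direction \<open>z - x\<close> is
  \<open>p x (z - x) - x' (z - x)\<close>. Two solutions \<open>x\<close> and \<open>y\<close>, tested against each other, satisfy
  \<open>p (x - y) (x - y) \<le> 0\<close>.
\<close>

lemma symmetric_coercive_variational_inequality:
  fixes p :: "'a::banach \<Rightarrow> 'a \<Rightarrow> real" and x' :: "'a \<Rightarrow>\<^sub>L real"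
  assumes bil: "bounded_bilinear p" and sym: "\<And>x y. p x y = p y x"
    and coer: "coercive_on UNIV p"
    and M: "M \<noteq> {}" "closed M" "convex M"
  shows "\<exists>!x. x \<in> M \<and> (\<forall>z\<in>M. p x (z - x) \<ge> x' (z - x))"
proof -
  interpret p: bounded_bilinear p by (rule bil)
  obtain c where c: "c > 0" "\<And>x. c * (norm x)\<^sup>2 \<le> p x x"
    using coer unfolding coercive_on_def by auto
  define J where "J z = p z z / 2 - x' z" for z
  have bound: "- (norm x')\<^sup>2 / (2 * c) \<le> J z" for z
  proof -
    have "x' z \<le> norm x' * norm z"
      using norm_blinfun[of x' z] by simp
    then have "J z \<ge> c / 2 * (norm z)\<^sup>2 - norm x' * norm z"
      using c(2)[of z] by (simp add: J_def)
    moreover have "c / 2 * (norm z)\<^sup>2 - norm x' * norm z + (norm x')\<^sup>2 / (2 * c)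
        = (c * norm z - norm x')\<^sup>2 / (2 * c)"
      using c(1) by (simp add: field_simps power2_eq_square)
    moreover have "(c * norm z - norm x')\<^sup>2 / (2 * c) \<ge> 0"
      using c(1) by simp
    ultimately show ?thesis by linarith
  qed
  define m where "m = (INF z\<in>M. J z)"
  have bdd: "bdd_below (J ` M)"
    by (rule bdd_belowI2[where m = "- (norm x')\<^sup>2 / (2 * c)"]) (rule bound)
  have m_le: "m \<le> J z" if "z \<in> M" for z
    unfolding m_def using bdd that by (rule cINF_lower)
  have "\<exists>z\<in>M. J z < m + inverse (real (Suc n))" for n
  proof -
    have "Inf (J ` M) < m + inverse (real (Suc n))" by (simp add: m_def)
    then show ?thesis using M(1) bdd by (subst (asm) cInf_less_iff) auto
  qed
  then obtain u where u: "\<And>n. u n \<in> M" "\<And>n. J (u n) < m + inverse (real (Suc n))"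
    by metis
  have mid: "p (x - y) (x - y) \<le> 4 * J x + 4 * J y - 8 * m" if "x \<in> M" "y \<in> M" for x y
  proof -
    have "(1/2) *\<^sub>R x + (1/2) *\<^sub>R y \<in> M"
      using M(3) that by (auto intro: convexD)
    then have "m \<le> J ((1/2) *\<^sub>R x + (1/2) *\<^sub>R y)" by (rule m_le)
    also have "\<dots> = (J x + J y) / 2 - p (x - y) (x - y) / 8"
      by (simp add: J_def p.add_left p.add_right p.diff_left p.diff_right p.scaleR_left
          p.scaleR_right blinfun.add_right blinfun.scaleR_right sym[of y x] field_simps)
    finally show ?thesis by (simp add: field_simps)
  qed
  have J0: "(\<lambda>n. J (u n)) \<longlonglongrightarrow> m"
  proof (rule tendsto_sandwich)
    show "\<forall>\<^sub>F n in sequentially. m \<le> J (u n)" using m_le u(1) by simp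
    show "\<forall>\<^sub>F n in sequentially. J (u n) \<le> m + inverse (real (Suc n))"
      by (intro always_eventually allI less_imp_le u(2))
    show "(\<lambda>n. m + inverse (real (Suc n))) \<longlonglongrightarrow> m"
      using tendsto_add[OF tendsto_const[of m] LIMSEQ_inverse_real_of_nat] by simp
  qed simp
  have "Cauchy u"
  proof (rule CauchyI)
    fix e :: real assume e: "e > 0"
    then have "c * e\<^sup>2 / 8 > 0" using c(1) by simp
    then have "\<forall>\<^sub>F n in sequentially. J (u n) < m + c * e\<^sup>2 / 8"
      by (intro order_tendstoD(2)[OF J0]) simp
    then obtain N where N: "\<And>n. n \<ge> N \<Longrightarrow> J (u n) < m + c * e\<^sup>2 / 8"
      unfolding eventually_sequentially by blast
    have "norm (u i - u j) < e" if "i \<ge> N" "j \<ge> N" for i j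
    proof -
      have "c * (norm (u i - u j))\<^sup>2 < c * e\<^sup>2"
        using c(2)[of "u i - u j"] mid[OF u(1) u(1), of i j] N[OF that(1)] N[OF that(2)]
        by linarith
      then show ?thesis using c(1) e by (simp add: power_less_imp_less_base)
    qed
    then show "\<exists>N. \<forall>i\<ge>N. \<forall>j\<ge>N. norm (u i - u j) < e" by blast
  qed
  then obtain x where x: "u \<longlonglongrightarrow> x"
    using Cauchy_convergent_iff convergent_def by blast
  have xM: "x \<in> M"
    using closed_sequentially[OF M(2) u(1) x] .
  have "(\<lambda>n. J (u n)) \<longlonglongrightarrow> J x"
    unfolding J_def by (intro tendsto_intros p.tendsto x) simp
  then have Jx: "J x = m" using J0 LIMSEQ_unique by blast
  have sol: "p x (z - x) \<ge> x' (z - x)" if z: "z \<in> M" for z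
  proof (rule field_le_epsilon)
    fix e :: real assume e: "e > 0"
    define q where "q = p (z - x) (z - x)"
    have q: "q \<ge> 0"
      unfolding q_def using c(2)[of "z - x"] c(1)
      by (meson mult_nonneg_nonneg less_imp_le order_trans zero_le_power2)
    \<comment> \<open>A step short enough that the second-order term \<open>t * q / 2\<close> of the expansion is below \<open>e\<close>.\<close>
    define t where "t = min 1 (e / (q + 1))"
    have t: "0 < t" "t \<le> 1" "t * q \<le> e"
    proof -
      show "0 < t" "t \<le> 1" using e q by (auto simp: t_def)
      have "t * q \<le> e / (q + 1) * q" using q by (intro mult_right_mono) (auto simp: t_def)
      also have "\<dots> \<le> e" using e q by (simp add: field_simps)
      finally show "t * q \<le> e" .
    qed
    have "(1 - t) *\<^sub>R x + t *\<^sub>R z \<in> M"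
      using M(3) xM z t by (auto intro: convexD)
    then have "J x \<le> J ((1 - t) *\<^sub>R x + t *\<^sub>R z)" unfolding Jx by (rule m_le)
    also have "(1 - t) *\<^sub>R x + t *\<^sub>R z = x + t *\<^sub>R (z - x)"
      by (simp add: algebra_simps)
    also have "J \<dots> = J x + t * (p x (z - x) - x' (z - x) + t * q / 2)"
      by (simp add: J_def q_def p.add_left p.add_right p.scaleR_left p.scaleR_right
          blinfun.add_right blinfun.scaleR_right sym[of "z - x" x] ring_distribs
          add_divide_distrib diff_divide_distrib)
    finally have "0 \<le> p x (z - x) - x' (z - x) + t * q / 2"
      using t(1) by (simp add: zero_le_mult_iff)
    then show "x' (z - x) \<le> p x (z - x) + e" using t(3) e by linarith
  qed
  show ?thesis
  proof (rule ex1I[of _ x])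
    show "x \<in> M \<and> (\<forall>z\<in>M. p x (z - x) \<ge> x' (z - x))" using xM sol by blast
    fix y assume y: "y \<in> M \<and> (\<forall>z\<in>M. p y (z - y) \<ge> x' (z - y))"
    have "p y (x - y) \<ge> x' (x - y)" "p x (y - x) \<ge> x' (y - x)"
      using y xM sol by auto
    then have "p (x - y) (x - y) \<le> 0"
      by (simp add: p.diff_left p.diff_right blinfun.diff_right)
    then have "c * (norm (x - y))\<^sup>2 \<le> 0" using c(2)[of "x - y"] by linarith
    then have "(norm (x - y))\<^sup>2 \<le> 0" using c(1) by (simp add: mult_le_0_iff)
    then show "y = x" by simp
  qed
qed

section \<open>Hilbert spaces and coercive forms\<close>

lemma isomorphic_to_hilbert_space_obtains_form:
  assumes "isomorphic_to_hilbert_space TYPE('a::real_normed_vector)"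
  obtains p :: "'a::real_normed_vector \<Rightarrow> 'a \<Rightarrow> real"
  where "bounded_bilinear p" "\<And>x y. p x y = p y x" "coercive_on UNIV p"
proof -
  obtain H :: "'a inner_module" and T :: "'a \<Rightarrow> 'a"
    where "real_hilbert_space H" and T: "linear_homeomorphism T H"
    using assms unfolding isomorphic_to_hilbert_space_def by blast
  interpret H: real_hilbert_space H by fact
  have bij: "bij_betw T UNIV (carrier H)"
    and add: "\<And>x y. T (x + y) = T x \<oplus>\<^bsub>H\<^esub> T y"
    and scale: "\<And>r x. T (r *\<^sub>R x) = r \<odot>\<^bsub>H\<^esub> T x"
    using T by (auto simp: linear_homeomorphism_def)
  obtain C where C: "\<And>x. iprod_norm H (T x) \<le> C * norm x"
    using T unfolding linear_homeomorphism_def by blast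
  obtain D where D: "\<And>y. y \<in> carrier H \<Longrightarrow> norm (inv_into UNIV T y) \<le> D * iprod_norm H y"
    using T unfolding linear_homeomorphism_def by blast
  have car [simp]: "T x \<in> carrier H" for x
    using bij by (auto simp: bij_betw_def)
  have D': "norm x \<le> D * iprod_norm H (T x)" for x
    using D[OF car[of x]] bij by (simp add: bij_betw_def inv_into_f_f)
  have nn: "iprod_norm H (T x) \<ge> 0" for x
    by (simp add: iprod_norm_def H.iprod_nonneg)
  define p where "p x y = iprod H (T x) (T y)" for x y
  have pn: "p x x = (iprod_norm H (T x))\<^sup>2" for x
    by (simp add: p_def iprod_norm_def H.iprod_nonneg)
  have CS: "\<bar>p x y\<bar> \<le> iprod_norm H (T x) * iprod_norm H (T y)" for x y
    using H.Cauchy_Schwarz[OF car car, of x y] unfolding p_def iprod_norm_def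
    by (metis real_sqrt_abs real_sqrt_le_iff real_sqrt_mult)
  show thesis
  proof
    show "bounded_bilinear p"
    proof
      show "\<exists>K. \<forall>x y. norm (p x y) \<le> norm x * norm y * K"
      proof (intro exI[of _ "C * C"] allI)
        fix x y
        have "\<bar>p x y\<bar> \<le> (C * norm x) * (C * norm y)"
          using CS[of x y] C nn
          by (meson mult_mono order_trans)
        then show "norm (p x y) \<le> norm x * norm y * (C * C)"
          by (simp add: mult_ac)
      qed
    qed (auto simp: p_def add scale H.iprod_add_left H.iprod_add_right
        H.iprod_smult_left H.iprod_smult_right)
    show "p x y = p y x" for x y
      by (simp add: p_def H.iprod_commute)
    show "coercive_on UNIV p"
      unfolding coercive_on_def
      \<comment> \<open>The summand 1 keeps the constant positive on the trivial space, where \<open>D\<close> may be 0.\<close>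
    proof (intro exI[of _ "1 / (D\<^sup>2 + 1)"] conjI ballI)
      show "1 / (D\<^sup>2 + 1) > 0"
        by (intro divide_pos_pos add_nonneg_pos) auto
      fix x
      have "(norm x)\<^sup>2 \<le> (D * iprod_norm H (T x))\<^sup>2"
        using D' by (intro power_mono) auto
      also have "\<dots> \<le> (D\<^sup>2 + 1) * p x x"
        by (simp add: pn power_mult_distrib algebra_simps)
      finally show "1 / (D\<^sup>2 + 1) * (norm x)\<^sup>2 \<le> p x x"
        using add_nonneg_pos[of "D\<^sup>2" 1] by (simp add: pos_divide_le_eq mult.commute)
    qed
  qed
qed

text \<open>
  The symmetric part of \<open>a\<close> agrees with \<open>a\<close> on the diagonal, so its norm lies between multiples of
  the given norm: below by coercivity, above by boundedness. The identity is the isomorphism.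
\<close>

lemma coercive_form_imp_isomorphic_to_hilbert_space:
  fixes a :: "'a::banach \<Rightarrow> 'a \<Rightarrow> real"
  assumes bil: "bounded_bilinear a" and coer: "coercive_on UNIV a"
  shows "isomorphic_to_hilbert_space TYPE('a)"
proof -
  interpret a: bounded_bilinear a by (rule bil)
  obtain c where c: "c > 0" "\<And>x. c * (norm x)\<^sup>2 \<le> a x x"
    using coer unfolding coercive_on_def by auto
  obtain B where B: "\<And>x y. norm (a x y) \<le> norm x * norm y * B" "B \<ge> 0"
    using a.nonneg_bounded by blast
  define s where "s x y = (a x y + a y x) / 2" for x y
  have ss: "s x x = a x x" for x by (simp add: s_def)
  let ?H = "type_inner_module s"
  have lower: "sqrt c * norm x \<le> iprod_norm ?H x" for x
    using real_sqrt_le_mono[OF c(2)[of x]] by (simp add: iprod_norm_def ss real_sqrt_mult)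
  have upper: "iprod_norm ?H x \<le> sqrt B * norm x" for x
  proof -
    have "a x x \<le> B * (norm x)\<^sup>2"
      using B(1)[of x x] by (simp add: power2_eq_square mult_ac)
    from real_sqrt_le_mono[OF this] show ?thesis
      by (simp add: iprod_norm_def ss real_sqrt_mult)
  qed
  have dist: "iprod_dist ?H x y = iprod_norm ?H (x - y)" for x y
    by (simp add: iprod_dist_def)
  have ip: "real_inner_product_space ?H"
  proof (intro real_inner_product_space.intro real_inner_product_space_axioms.intro
      module_type_inner_module)
    fix x
    show "iprod ?H x x \<ge> 0"
      using c(2)[of x] c(1) by (simp add: ss) (meson mult_nonneg_nonneg less_imp_le order_trans zero_le_power2)
    show "iprod ?H x x = 0 \<longleftrightarrow> x = \<zero>\<^bsub>?H\<^esub>"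
    proof
      assume "iprod ?H x x = 0"
      then have "c * (norm x)\<^sup>2 \<le> 0" using c(2)[of x] by (simp add: ss)
      then show "x = \<zero>\<^bsub>?H\<^esub>" using c(1) by (simp add: mult_le_0_iff)
    qed (simp add: ss a.zero_left)
  qed (auto simp: s_def a.add_left a.add_right a.scaleR_left a.scaleR_right algebra_simps add_divide_distrib)
  interpret H: real_inner_product_space ?H by (rule ip)
  have "H.IP.mcomplete"
    unfolding H.IP.mcomplete_def
  proof (intro allI impI)
    fix u assume u: "H.IP.MCauchy u"
    have "Cauchy u"
    proof (rule CauchyI)
      fix e :: real assume "e > 0"
      then have "sqrt c * e > 0" using c(1) by simp
      then obtain N where N: "\<And>i j. N \<le> i \<Longrightarrow> N \<le> j \<Longrightarrow> iprod_dist ?H (u i) (u j) < sqrt c * e"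
        using u unfolding H.IP.MCauchy_def by blast
      have "norm (u i - u j) < e" if "N \<le> i" "N \<le> j" for i j
      proof -
        have "sqrt c * norm (u i - u j) < sqrt c * e"
          using N[OF that] lower[of "u i - u j"] by (simp add: dist)
        then show ?thesis using c(1) by simp
      qed
      then show "\<exists>N. \<forall>i\<ge>N. \<forall>j\<ge>N. norm (u i - u j) < e" by blast
    qed
    then obtain x where x: "u \<longlonglongrightarrow> x"
      using Cauchy_convergent_iff convergent_def by blast
    have "(\<lambda>n. iprod_dist ?H (u n) x) \<longlonglongrightarrow> 0"
    proof (rule tendsto_sandwich[OF _ _ tendsto_const])
      show "\<forall>\<^sub>F n in sequentially. 0 \<le> iprod_dist ?H (u n) x" by simp
      show "(\<lambda>n. sqrt B * norm (u n - x)) \<longlonglongrightarrow> 0"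
        using x by (intro tendsto_mult_right_zero) (simp add: LIM_zero tendsto_norm_zero)
      show "\<forall>\<^sub>F n in sequentially. iprod_dist ?H (u n) x \<le> sqrt B * norm (u n - x)"
        using upper by (simp add: dist)
    qed
    then have "limitin H.IP.mtopology u x sequentially"
      unfolding H.IP.limitin_metric_dist_null by simp
    then show "\<exists>x. limitin H.IP.mtopology u x sequentially" ..
  qed
  then have "real_hilbert_space ?H"
    by (intro real_hilbert_space.intro real_hilbert_space_axioms.intro ip)
  moreover have "linear_homeomorphism id ?H"
    unfolding linear_homeomorphism_def
  proof (intro conjI)
    show "\<exists>C. \<forall>x. iprod_norm ?H (id x) \<le> C * norm x" using upper by auto
    have "norm x \<le> inverse (sqrt c) * iprod_norm ?H x" for x
      using lower[of x] c(1) by (simp add: field_simps)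
    then show "\<exists>C. \<forall>y\<in>carrier ?H. norm (inv_into UNIV id y) \<le> C * iprod_norm ?H y"
      by (auto simp: inv_id[unfolded id_def] id_def)
  qed auto
  ultimately show ?thesis
    unfolding isomorphic_to_hilbert_space_def by blast
qed

section \<open>Positive forms on subspaces of finite codimension\<close>

text \<open>
  If \<open>a\<close> were not coercive on \<open>W\<close>, there would be unit vectors \<open>v n \<in> W\<close> with \<open>a (v n) (v n) \<longlonglongrightarrow> 0\<close>, and
  after passing to a subsequence \<open>f (v n)\<close> converges. Up to a vanishing multiple of a vector \<open>e\<close>
  with \<open>f e = 1\<close>, the differences \<open>v i - v j\<close> then lie in the kernel of \<open>f\<close>, where coercivity makes
  them small in norm. So \<open>v\<close> converges to a unit vector of the whole space, which contradicts
  strict positivity there.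
\<close>

lemma coercive_on_kernel_imp_coercive_on:
  fixes a :: "'a::banach \<Rightarrow> 'a \<Rightarrow> real"
  assumes bil: "bounded_bilinear a" and pos: "\<And>x. x \<noteq> 0 \<Longrightarrow> a x x > 0"
    and W: "subspace W" and f: "bounded_linear f"
    and coer: "coercive_on {x \<in> W. f x = (0::real)} a"
  shows "coercive_on W a"
proof (cases "\<forall>x\<in>W. f x = 0")
  case True
  then have "{x \<in> W. f x = 0} = W" by blast
  then show ?thesis using coer by simp
next
  case False
  interpret a: bounded_bilinear a by (rule bil)
  interpret f: bounded_linear f by (rule f)
  have nonneg: "a x x \<ge> 0" for x
    using pos[of x] by (cases "x = 0") (auto simp: a.zero_left)
  have quad_diff: "a (x - y) (x - y) \<le> 2 * a x x + 2 * a y y" for x y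
    using nonneg[of "x + y"] by (simp add: a.diff_left a.diff_right a.add_left a.add_right)
  obtain c where c: "c > 0" "\<And>x. x \<in> W \<Longrightarrow> f x = 0 \<Longrightarrow> c * (norm x)\<^sup>2 \<le> a x x"
    using coer unfolding coercive_on_def by blast
  obtain e0 where "e0 \<in> W" "f e0 \<noteq> 0" using False by blast
  define e where "e = inverse (f e0) *\<^sub>R e0"
  have e: "e \<in> W" "f e = 1"
    using \<open>e0 \<in> W\<close> \<open>f e0 \<noteq> 0\<close> W by (auto simp: e_def f.scaleR subspace_scale)
  show ?thesis
  proof (rule ccontr)
    assume non: "\<not> coercive_on W a"
    have "\<exists>x\<in>W. norm x = 1 \<and> a x x < inverse (real (Suc n))" for n
    proof -
      have "inverse (real (Suc n)) > 0" by simp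
      then obtain y where y: "y \<in> W" "a y y < inverse (real (Suc n)) * (norm y)\<^sup>2"
        using non unfolding coercive_on_def by (meson not_le)
      then have y0: "norm y > 0" using nonneg[of y] by (cases "y = 0") auto
      define x where "x = inverse (norm y) *\<^sub>R y"
      have "a x x * (norm y)\<^sup>2 = a y y"
        using y0 by (simp add: x_def a.scaleR_left a.scaleR_right power2_eq_square field_simps)
      then have "a x x < inverse (real (Suc n))"
        using y(2) y0 by (metis mult_less_cancel_right_pos zero_less_power)
      then show ?thesis
        using y(1) y0 W by (intro bexI[of _ x]) (auto simp: x_def subspace_scale)
    qed
    then obtain u where u: "\<And>n. u n \<in> W" "\<And>n. norm (u n) = 1"
        "\<And>n. a (u n) (u n) < inverse (real (Suc n))"
      by metis
    have "bounded (range (\<lambda>n. f (u n)))"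
    proof -
      obtain K where "\<And>x. norm (f x) \<le> norm x * K" using f.bounded by blast
      then have "norm (f (u n)) \<le> K" for n using u(2)[of n] by (metis mult_1)
      then show ?thesis unfolding bounded_iff by blast
    qed
    then obtain l r where r: "strict_mono r" "((\<lambda>n. f (u n)) \<circ> r) \<longlonglongrightarrow> l"
      using bounded_imp_convergent_subsequence by blast
    define v where "v = u \<circ> r"
    have v: "v n \<in> W" "norm (v n) = 1" for n using u by (auto simp: v_def)
    have qv: "(\<lambda>n. a (v n) (v n)) \<longlonglongrightarrow> 0"
    proof -
      have "(\<lambda>n. a (u n) (u n)) \<longlonglongrightarrow> 0"
        by (rule tendsto_sandwich[OF _ _ tendsto_const LIMSEQ_inverse_real_of_nat])
          (intro always_eventually allI less_imp_le[OF u(3)] nonneg)+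
      from LIMSEQ_subseq_LIMSEQ[OF this r(1)] show ?thesis by (simp add: v_def o_def)
    qed
    have fv: "Cauchy (\<lambda>n. f (v n))"
      using LIMSEQ_imp_Cauchy[OF r(2)] by (simp add: v_def o_def)
    have split: "c * (norm (v i - v j - (f (v i) - f (v j)) *\<^sub>R e))\<^sup>2
        \<le> 4 * a (v i) (v i) + 4 * a (v j) (v j) + 2 * (f (v i) - f (v j))\<^sup>2 * a e e" for i j
    proof -
      let ?t = "f (v i) - f (v j)"
      let ?y = "v i - v j - ?t *\<^sub>R e"
      have "?y \<in> W" "f ?y = 0"
        using v(1) e W by (auto simp: subspace_diff subspace_scale f.diff f.scaleR)
      then have "c * (norm ?y)\<^sup>2 \<le> a ?y ?y" by (rule c(2))
      also have "\<dots> \<le> 2 * a (v i - v j) (v i - v j) + 2 * a (?t *\<^sub>R e) (?t *\<^sub>R e)"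
        by (rule quad_diff)
      also have "a (?t *\<^sub>R e) (?t *\<^sub>R e) = ?t\<^sup>2 * a e e"
        by (simp add: a.scaleR_left a.scaleR_right power2_eq_square)
      finally show ?thesis using quad_diff[of "v i" "v j"] by linarith
    qed
    have "Cauchy v"
    proof (rule CauchyI)
      fix d :: real assume d: "d > 0"
      define h where "h = d / 2"
      have h: "h > 0" using d by (simp add: h_def)
      \<comment> \<open>Allowed size of \<open>f (v i) - f (v j)\<close>: the first bound keeps the correction along \<open>e\<close> below \<open>h\<close>
        in norm, the second keeps its value under the quadratic form below \<open>c * h\<^sup>2 / 4\<close>.\<close>
      define k where "k = min (h / (norm e + 1)) (sqrt (c * h\<^sup>2 / (4 * (a e e + 1))))"
      have aee: "a e e + 1 > 0" using nonneg[of e] by linarith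
      have k: "k > 0" using h c(1) aee by (auto simp: k_def add_nonneg_pos)
      have k1: "k * norm e < h"
      proof -
        have "k * norm e \<le> h / (norm e + 1) * norm e" by (intro mult_right_mono) (auto simp: k_def)
        also have "\<dots> < h"
          using h norm_ge_zero[of e] by (simp add: pos_divide_less_eq add_nonneg_pos)
        finally show ?thesis .
      qed
      have k2: "k\<^sup>2 * a e e \<le> c * h\<^sup>2 / 4"
      proof -
        have "k\<^sup>2 \<le> (sqrt (c * h\<^sup>2 / (4 * (a e e + 1))))\<^sup>2"
          using k by (intro power_mono) (auto simp: k_def)
        also have "\<dots> = c * h\<^sup>2 / (4 * (a e e + 1))" using c(1) aee by simp
        finally have "k\<^sup>2 * (a e e + 1) \<le> c * h\<^sup>2 / 4" using aee by (simp add: field_simps)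
        then show ?thesis by (simp add: algebra_simps) (smt (verit) zero_le_power2)
      qed
      obtain N1 where N1: "\<And>i j. i \<ge> N1 \<Longrightarrow> j \<ge> N1 \<Longrightarrow> \<bar>f (v i) - f (v j)\<bar> < k"
        using CauchyD[OF fv k] by auto
      have "c * h\<^sup>2 / 16 > 0" using c(1) h by simp
      from order_tendstoD(2)[OF qv this] obtain N2
        where N2: "\<And>i. i \<ge> N2 \<Longrightarrow> a (v i) (v i) < c * h\<^sup>2 / 16"
        unfolding eventually_sequentially by blast
      have "norm (v i - v j) < d" if ij: "i \<ge> max N1 N2" "j \<ge> max N1 N2" for i j
      proof -
        let ?t = "f (v i) - f (v j)"
        have t: "\<bar>?t\<bar> < k" using N1 ij by simp
        have "?t\<^sup>2 * a e e \<le> k\<^sup>2 * a e e"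
          using t nonneg[of e] power_mono[of "\<bar>?t\<bar>" k 2] by (intro mult_right_mono) auto
        then have "c * (norm (v i - v j - ?t *\<^sub>R e))\<^sup>2 < c * h\<^sup>2"
          using split[of i j] N2[of i] N2[of j] ij k2 by simp
        then have "norm (v i - v j - ?t *\<^sub>R e) < h"
          using c(1) h by (simp add: power_less_imp_less_base)
        moreover have "norm (?t *\<^sub>R e) < h"
          using k1 t mult_right_mono[of "\<bar>?t\<bar>" k "norm e"] by simp
        ultimately show ?thesis
          using norm_triangle_ineq[of "v i - v j - ?t *\<^sub>R e" "?t *\<^sub>R e"] by (simp add: h_def)
      qed
      then show "\<exists>N. \<forall>i\<ge>N. \<forall>j\<ge>N. norm (v i - v j) < d" by blast
    qed
    then obtain x where x: "v \<longlonglongrightarrow> x"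
      using Cauchy_convergent_iff convergent_def by blast
    have "a x x = 0" using LIMSEQ_unique[OF a.tendsto[OF x x] qv] .
    moreover have "norm x = 1"
      using LIMSEQ_unique[OF tendsto_norm[OF x]] v(2) by simp
    ultimately show False using pos[of x] by force
  qed
qed

lemma coercive_on_finite_kernel_imp_coercive:
  fixes a :: "'a::banach \<Rightarrow> 'a \<Rightarrow> real"
  assumes bil: "bounded_bilinear a" and pos: "\<And>x. x \<noteq> 0 \<Longrightarrow> a x x > 0"
    and "finite F" and "\<And>f. f \<in> F \<Longrightarrow> bounded_linear f"
    and "coercive_on {x. \<forall>f\<in>F. f x = (0::real)} a"
  shows "coercive_on UNIV a"
  using assms(3-5)
proof (induction F)
  case (insert f F)
  let ?W = "{x. \<forall>f\<in>F. f x = 0}"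
  have "linear g" if "g \<in> F" for g
    using insert.prems(1) that bounded_linear.linear by blast
  then have "subspace ?W"
    by (auto simp: subspace_def linear_add linear_scale linear_0)
  moreover have "{x. \<forall>g\<in>insert f F. g x = 0} = {x \<in> ?W. f x = 0}" by blast
  ultimately have "coercive_on ?W a"
    using coercive_on_kernel_imp_coercive_on[OF bil pos, of ?W f] insert.prems by simp
  then show ?case using insert by blast
qed simp

section \<open>Stampacchia forms are coercive\<close>

lemma subspace_closure_span: "subspace (closure (span S))"
  for S :: "'a::real_normed_vector set"
proof (rule subspaceI)
  show "0 \<in> closure (span S)" using closure_subset span_zero by blast
next
  fix x y assume "x \<in> closure (span S)" "y \<in> closure (span S)"
  then obtain u v where "\<And>n. u n \<in> span S" "u \<longlonglongrightarrow> x" "\<And>n. v n \<in> span S" "v \<longlonglongrightarrow> y"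
    unfolding closure_sequential by blast
  then have "(\<lambda>n. u n + v n) \<longlonglongrightarrow> x + y" "\<forall>n. u n + v n \<in> span S"
    by (auto intro: tendsto_add span_add)
  then show "x + y \<in> closure (span S)" unfolding closure_sequential by (intro exI conjI)
next
  fix c x assume "x \<in> closure (span S)"
  then obtain u where "\<And>n. u n \<in> span S" "u \<longlonglongrightarrow> x"
    unfolding closure_sequential by blast
  then have "(\<lambda>n. c *\<^sub>R u n) \<longlonglongrightarrow> c *\<^sub>R x" "\<forall>n. c *\<^sub>R u n \<in> span S"
    by (auto intro: tendsto_scaleR span_scale)
  then show "c *\<^sub>R x \<in> closure (span S)" unfolding closure_sequential by (intro exI conjI)
qed

locale stampacchia_form = bounded_bilinear a for a :: "'a::banach \<Rightarrow> 'a \<Rightarrow> real" +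
  assumes unique_solution:
    "\<And>(M :: 'a set) (x' :: 'a \<Rightarrow>\<^sub>L real). M \<noteq> {} \<Longrightarrow> closed M \<Longrightarrow> convex M \<Longrightarrow>
      \<exists>!x. x \<in> M \<and> (\<forall>z\<in>M. a x (z - x) \<ge> x' (z - x))"
begin

text \<open>
  If \<open>a x x \<le> 0\<close>, both end points of the segment from 0 to \<open>x\<close> solve the inequality with zero
  functional, so uniqueness forces \<open>x = 0\<close>.
\<close>

lemma diagonal_pos:
  assumes "x \<noteq> 0"
  shows "a x x > 0"
proof (rule ccontr)
  assume "\<not> a x x > 0"
  then have le: "a x x \<le> 0" by simp
  let ?S = "closed_segment 0 x"
  have "a x (z - x) \<ge> 0" if "z \<in> ?S" for z
  proof -
    obtain t where t: "0 \<le> t" "t \<le> 1" "z = t *\<^sub>R x"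
      using \<open>z \<in> ?S\<close> by (auto simp: closed_segment_def)
    then have "a x (z - x) = (t - 1) * a x x"
      by (simp add: diff_right scaleR_right algebra_simps)
    then show ?thesis using t le by (simp add: mult_nonpos_nonpos)
  qed
  moreover have "\<exists>!y. y \<in> ?S \<and> (\<forall>z\<in>?S. a y (z - y) \<ge> (0 :: 'a \<Rightarrow>\<^sub>L real) (z - y))"
    by (rule unique_solution) auto
  ultimately have "x = 0"
    by (auto simp: zero_left zero_blinfun.rep_eq)
  with assms show False by simp
qed

text \<open>
  A quantitative Hahn-Banach theorem for single vectors, with constant 2 instead of 1. Let \<open>u\<close> solve
  the inequality on the unit ball for the functional \<open>a (2 *\<^sub>R x)\<close>, a kind of projection of \<open>2 *\<^sub>R x\<close>.
  The functional \<open>a y\<close> with \<open>y = 2 *\<^sub>R x - u\<close> attains its maximum over the ball, which is its norm,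
  at \<open>u\<close>. Since \<open>a y (2 *\<^sub>R x - u) > 0\<close> by positivity, its norm is less than \<open>2 * a y x\<close>.
\<close>

lemma unit_vector_functional:
  assumes "norm x = 1"
  obtains f :: "'a \<Rightarrow>\<^sub>L real" where "norm f \<le> 2" "f x = 1"
proof -
  let ?A = "\<lambda>x. Blinfun (a x)"
  have A: "blinfun_apply (?A y) = a y" for y
    by (rule bounded_linear_Blinfun_apply) (rule bounded_linear_right)
  obtain u where u: "norm u \<le> 1" "\<And>z. norm z \<le> 1 \<Longrightarrow> a u (z - u) \<ge> a (2 *\<^sub>R x) (z - u)"
    using unique_solution[of "cball 0 1" "?A (2 *\<^sub>R x)"] by (auto simp: A)
  define y where "y = 2 *\<^sub>R x - u"
  have max: "a y z \<le> a y u" if "norm z \<le> 1" for z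
    using u(2)[OF that] by (simp add: y_def diff_left diff_right)
  have "y \<noteq> 0" using u(1) assms by (auto simp: y_def)
  then have "a y y > 0" by (rule diagonal_pos)
  then have less: "a y u < 2 * a y x"
    by (simp add: y_def diff_right scaleR_right)
  have bound: "\<bar>a y z\<bar> \<le> a y u * norm z" for z
  proof (cases "z = 0")
    case False
    define w where "w = inverse (norm z) *\<^sub>R z"
    have w: "norm w = 1" "a y z = norm z * a y w" using False by (auto simp: w_def scaleR_right)
    have "\<bar>a y w\<bar> \<le> a y u"
      using max[of w] max[of "- w"] w(1) by (simp add: minus_right abs_le_iff)
    then show ?thesis using w(2) by (simp add: abs_mult mult.commute mult_left_mono)
  qed (simp add: zero_right)
  have ax: "a y x > 0" using less max[of 0] by (simp add: zero_right)
  define f where "f = inverse (a y x) *\<^sub>R ?A y"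
  show thesis
  proof
    show "f x = 1" using ax by (simp add: f_def A scaleR_blinfun.rep_eq)
    show "norm f \<le> 2"
    proof (rule norm_blinfun_bound)
      fix z
      have "\<bar>a y z\<bar> \<le> 2 * a y x * norm z"
        using bound[of z] mult_right_mono[OF less_imp_le[OF less], of "norm z"] by simp
      then show "norm (f z) \<le> 2 * norm z"
        using ax by (simp add: f_def A scaleR_blinfun.rep_eq abs_mult field_simps)
    qed simp
  qed
qed

lemma solution_on_closed_subspace:
  fixes x' :: "'a \<Rightarrow>\<^sub>L real"
  assumes "subspace V" "closed V"
  obtains x where "x \<in> V" "\<And>v. v \<in> V \<Longrightarrow> a x v = x' v"
proof -
  have "V \<noteq> {}" using subspace_0[OF assms(1)] by blast
  then obtain x where x: "x \<in> V" "\<And>z. z \<in> V \<Longrightarrow> a x (z - x) \<ge> x' (z - x)"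
    using unique_solution[OF _ assms(2) subspace_imp_convex[OF assms(1)], of x'] by blast
  show thesis
  proof (rule that[OF x(1)])
    fix v assume v: "v \<in> V"
    have "a x v \<ge> x' v"
      using x(2)[of "x + v"] x(1) v assms(1) by (simp add: subspace_add)
    moreover have "a x (- v) \<ge> x' (- v)"
      using x(2)[of "x - v"] x(1) v assms(1) by (simp add: subspace_diff)
    ultimately show "a x v = x' v" by (simp add: minus_right blinfun.minus_right)
  qed
qed

text \<open>
  Each new vector is taken from the common kernel of the finitely many functionals attached to its
  predecessors, on which \<open>a\<close> still fails to be coercive. The functional \<open>f n\<close> is chosen only
  after \<open>x n\<close>, so it is controlled on later vectors but not on earlier ones. Its bound is known
  beforehand, so the sequence \<open>\<epsilon>\<close> may be prescribed.
\<close>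

lemma obtain_orthogonal_sequence:
  fixes \<epsilon> :: "nat \<Rightarrow> real"
  assumes non: "\<not> coercive_on UNIV a" and eps: "\<And>n. \<epsilon> n > 0"
  obtains x :: "nat \<Rightarrow> 'a" and f :: "nat \<Rightarrow> 'a \<Rightarrow>\<^sub>L real"
  where "\<And>n. norm (x n) = 1" "\<And>n. a (x n) (x n) < \<epsilon> n"
    "\<And>i j. i \<noteq> j \<Longrightarrow> a (x i) (x j) = 0"
    "\<And>n. norm (f n) \<le> 2" "\<And>n. f n (x n) = 1" "\<And>i j. i < j \<Longrightarrow> f i (x j) = 0"
proof -
  define P where "P s n r \<longleftrightarrow>
      norm (fst r) = 1 \<and> a (fst r) (fst r) < \<epsilon> n \<and> norm (snd r) \<le> 2 \<and> blinfun_apply (snd r) (fst r) = 1 \<and>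
      (\<forall>i<n. a (fst (s i)) (fst r) = 0 \<and> a (fst r) (fst (s i)) = 0 \<and> blinfun_apply (snd (s i)) (fst r) = 0)"
    for s :: "nat \<Rightarrow> 'a \<times> ('a \<Rightarrow>\<^sub>L real)" and n and r :: "'a \<times> ('a \<Rightarrow>\<^sub>L real)"
  have "\<exists>s. \<forall>n. P s n (s n)"
  proof (rule dependent_wellorder_choice)
    fix n and s :: "nat \<Rightarrow> 'a \<times> ('a \<Rightarrow>\<^sub>L real)"
    define F where "F = (\<Union>i<n. {a (fst (s i)), (\<lambda>x. a x (fst (s i))), blinfun_apply (snd (s i))})"
    have "\<not> coercive_on {x. \<forall>f\<in>F. f x = 0} a"
    proof
      assume "coercive_on {x. \<forall>f\<in>F. f x = 0} a"
      then have "coercive_on UNIV a"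
        by (rule coercive_on_finite_kernel_imp_coercive[OF bounded_bilinear_axioms diagonal_pos, rotated -1])
          (auto simp: F_def bounded_linear_left bounded_linear_right blinfun.bounded_linear_right)
      with non show False ..
    qed
    then obtain y where y: "\<And>f. f \<in> F \<Longrightarrow> f y = 0" "a y y < \<epsilon> n * (norm y)\<^sup>2"
      unfolding coercive_on_def using eps[of n] by (metis (mono_tags, lifting) mem_Collect_eq not_le)
    have "y \<noteq> 0" using y(2) by (auto simp: zero_left)
    define x where "x = inverse (norm y) *\<^sub>R y"
    have nx: "norm x = 1" using \<open>y \<noteq> 0\<close> by (simp add: x_def)
    have "a x x * (norm y)\<^sup>2 = a y y"
      using \<open>y \<noteq> 0\<close> by (simp add: x_def scaleR_left scaleR_right power2_eq_square field_simps)
    then have ax: "a x x < \<epsilon> n"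
      using y(2) \<open>y \<noteq> 0\<close> by (metis mult_less_cancel_right_pos zero_less_norm_iff zero_less_power)
    have orth: "a (fst (s i)) x = 0" "a x (fst (s i)) = 0" "snd (s i) x = 0" if "i < n" for i
    proof -
      have "a (fst (s i)) \<in> F" "(\<lambda>x. a x (fst (s i))) \<in> F" "blinfun_apply (snd (s i)) \<in> F"
        using that by (auto simp: F_def)
      from this[THEN y(1)]
      show "a (fst (s i)) x = 0" "a x (fst (s i)) = 0" "snd (s i) x = 0"
        by (simp_all add: x_def scaleR_left scaleR_right blinfun.scaleR_right)
    qed
    obtain f :: "'a \<Rightarrow>\<^sub>L real" where "norm f \<le> 2" "f x = 1"
      using unit_vector_functional[OF nx] .
    then have "P s n (x, f)" using nx ax orth by (simp add: P_def)
    then show "\<exists>r. P s n r" ..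
  qed (simp add: P_def)
  then obtain s where s: "\<And>n. P s n (s n)" by blast
  show thesis
  proof (rule that[of "\<lambda>n. fst (s n)" "\<lambda>n. snd (s n)"])
    show "a (fst (s i)) (fst (s j)) = 0" if "i \<noteq> j" for i j
      using s[of i] s[of j] that unfolding P_def by (metis nat_neq_iff)
  qed (use s in \<open>auto simp: P_def\<close>)
qed

lemma coercive: "coercive_on UNIV a"
proof (rule ccontr)
  assume "\<not> coercive_on UNIV a"
  then obtain x :: "nat \<Rightarrow> 'a" and f :: "nat \<Rightarrow> 'a \<Rightarrow>\<^sub>L real"
    where x: "\<And>n. norm (x n) = 1" "\<And>n. a (x n) (x n) < (1/16)^n"
      and orth: "\<And>i j. i \<noteq> j \<Longrightarrow> a (x i) (x j) = 0"
      and f: "\<And>n. norm (f n) \<le> 2" "\<And>n. f n (x n) = 1" "\<And>i j. i < j \<Longrightarrow> f i (x j) = 0"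
    using obtain_orthogonal_sequence[of "\<lambda>n. (1/16)^n"] by auto
  have fb: "\<bar>f n w\<bar> \<le> 2 * norm w" for n w
    using norm_blinfun[of "f n" w] mult_right_mono[OF f(1)[of n], of "norm w"] by simp
  have app: "a (x n) (x n) > 0" for n
    using x(1)[of n] by (intro diagonal_pos) auto
  define V where "V = closure (span (range x))"
  have V: "subspace V" "closed V" by (auto simp: V_def subspace_closure_span)
  have xV: "x n \<in> V" for n
    unfolding V_def by (intro subsetD[OF closure_subset] span_base rangeI)

  \<comment> \<open>By orthogonality \<open>b n\<close> is the \<open>n\<close>-th coordinate of \<open>w \<in> V\<close> along the vectors \<open>x\<close>. Its continuity
    constant depends on \<open>a (x n) (x n)\<close>; the triangular system \<open>expand\<close> gives one that does not.\<close>
  define b where "b n w = a w (x n) / a (x n) (x n)" for n w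
  have blin: "bounded_linear (b n)" for n
    unfolding b_def by (intro bounded_linear_compose[OF bounded_linear_divide bounded_linear_left])
  have expand: "f n w = b n w + (\<Sum>i<n. f n (x i) * b i w)" if "w \<in> V" for n w
  proof -
    define g where "g w = f n w - (b n w + (\<Sum>i<n. f n (x i) * b i w))" for w
    have g: "bounded_linear g"
      unfolding g_def
      by (intro bounded_linear_sub bounded_linear_add bounded_linear_sum blin
          blinfun.bounded_linear_right bounded_linear_const_mult)
    have bx: "b i (x m) = (if m = i then 1 else 0)" for i m
      using app[of i] orth by (auto simp: b_def)
    have "g (x m) = 0" for m
    proof -
      have "(\<Sum>i<n. f n (x i) * b i (x m)) = (if m < n then f n (x m) else 0)"
        by (simp add: bx if_distrib[of "\<lambda>t. _ * t"] cong: if_cong)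
      then show ?thesis
        using f(2)[of n] f(3)[of n m] by (auto simp: g_def bx not_less)
    qed
    then have "span (range x) \<subseteq> {w. g w = 0}"
      by (intro span_minimal) (auto simp: subspace_def linear_add linear_scale linear_0
          bounded_linear.linear[OF g])
    moreover have "closed {w. g w = 0}"
      by (intro closed_Collect_eq continuous_on_const linear_continuous_on g)
    ultimately have "V \<subseteq> {w. g w = 0}" unfolding V_def by (rule closure_minimal)
    then show ?thesis using that by (auto simp: g_def)
  qed
  have bbound: "\<bar>b n w\<bar> \<le> 2 * 3^n * norm w" if w: "w \<in> V" for n w
  proof (induction n rule: less_induct)
    case (less n)
    have geo: "(\<Sum>i<n. (3::real)^i) = (3^n - 1) / 2"
      by (simp add: geometric_sum)
    have "\<bar>\<Sum>i<n. f n (x i) * b i w\<bar> \<le> (\<Sum>i<n. \<bar>f n (x i) * b i w\<bar>)"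
      by (rule sum_abs)
    also have "\<dots> \<le> (\<Sum>i<n. 2 * (2 * 3^i * norm w))"
    proof (rule sum_mono)
      fix i assume "i \<in> {..<n}"
      then show "\<bar>f n (x i) * b i w\<bar> \<le> 2 * (2 * 3^i * norm w)"
        unfolding abs_mult using less[of i] fb[of n "x i"] x(1)[of i]
        by (intro mult_mono) auto
    qed
    also have "\<dots> = 4 * norm w * (\<Sum>i<n. 3^i)"
      by (simp add: sum_distrib_left mult_ac)
    also have "\<dots> = 2 * 3^n * norm w - 2 * norm w"
      unfolding geo by (simp add: field_simps)
    finally show ?case
      using expand[OF w, of n] fb[of n w] by linarith
  qed

  \<comment> \<open>The weights decrease fast enough for the first nonzero term of \<open>x' (x n)\<close>, which is \<open>(1/5)^n\<close>, to
    dominate the rest: \<open>2 * (1/5)^(n+1) * (5/4) = (1/5)^n / 2\<close>.\<close>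
  define x' where "x' = (\<Sum>i. (1/5)^i *\<^sub>R f i)"
  have geom: "summable (\<lambda>i. (1/5::real)^i)" by (rule summable_geometric) simp
  have sumf: "summable (\<lambda>i. (1/5)^i *\<^sub>R f i)"
  proof (rule summable_comparison_test')
    show "summable (\<lambda>i. 2 * (1/5::real)^i)" by (intro summable_mult geom)
    show "norm ((1/5)^i *\<^sub>R f i) \<le> 2 * (1/5)^i" for i
      using f(1)[of i] by simp
  qed
  have x'_lower: "x' (x n) \<ge> (1/5)^n / 2" for n
  proof -
    define g where "g = (\<lambda>i. (1/5)^i * f i (x n))"
    have sums: "g sums x' (x n)"
    proof -
      have "(\<lambda>i. blinfun_apply ((1/5)^i *\<^sub>R f i) (x n)) sums blinfun_apply x' (x n)"
        unfolding x'_def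
        by (rule bounded_linear.sums[OF blinfun.bounded_linear_left summable_sums[OF sumf]])
      then show ?thesis by (simp add: g_def scaleR_blinfun.rep_eq)
    qed
    then have "(\<lambda>i. g (i + Suc n)) sums (x' (x n) - (\<Sum>i<Suc n. g i))"
      by (rule sums_split_initial_segment)
    moreover have "(\<Sum>i<Suc n. g i) = (1/5)^n"
      using f(2)[of n] f(3) by (simp add: g_def)
    ultimately have tail: "(\<lambda>i. g (i + Suc n)) sums (x' (x n) - (1/5)^n)" by simp
    have "(\<lambda>i. (1/5::real)^i) sums (5/4)"
      using geometric_sums[of "1/5::real"] by simp
    from sums_mult[OF this, of "- (2 * (1/5)^Suc n)"]
    have low: "(\<lambda>i. - (2 * (1/5)^(i + Suc n))) sums (- ((1/5)^n / 2) :: real)"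
      by (simp add: power_add mult_ac)
    have "- (2 * (1/5)^(i + Suc n)) \<le> g (i + Suc n)" for i
    proof -
      have "- 2 \<le> f (i + Suc n) (x n)" using fb[of "i + Suc n" "x n"] x(1)[of n] by simp
      from mult_left_mono[OF this, of "(1/5)^(i + Suc n)"] show ?thesis
        by (simp add: g_def)
    qed
    from sums_le[OF this low tail] have "- ((1/5)^n / 2) \<le> x' (x n) - (1/5)^n" .
    then show ?thesis by simp
  qed
  obtain w where w: "w \<in> V" "\<And>v. v \<in> V \<Longrightarrow> a w v = x' v"
    using solution_on_closed_subspace[OF V] by blast
  \<comment> \<open>Since \<open>3 / 16 < 1 / 5\<close>, the upper bound on \<open>a w (x n)\<close> falls below the lower one as \<open>n\<close> grows.\<close>
  have "(16/15)^n \<le> 4 * norm w" for n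
  proof -
    have "(1/5)^n / 2 \<le> a w (x n)"
      using x'_lower[of n] w(2)[OF xV] by simp
    also have "\<dots> = b n w * a (x n) (x n)"
      using app[of n] by (simp add: b_def)
    also have "\<dots> \<le> (2 * 3^n * norm w) * (1/16)^n"
      using bbound[OF w(1), of n] x(2)[of n] app[of n] by (intro mult_mono) auto
    finally show ?thesis by (simp add: field_simps flip: power_mult_distrib)
  qed
  moreover obtain n where "(16/15)^n > 4 * norm w"
    using real_arch_pow[of "16/15" "4 * norm w"] by auto
  ultimately show False by (metis not_le)
qed

end

theorem theorem2p4:
  shows "isomorphic_to_hilbert_space TYPE('a::banach) \<longleftrightarrow> stampacchia_property TYPE('a)"
proof
  assume "isomorphic_to_hilbert_space TYPE('a)"
  then obtain p :: "'a \<Rightarrow> 'a \<Rightarrow> real"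
    where p: "bounded_bilinear p" "\<And>x y. p x y = p y x" "coercive_on UNIV p"
    using isomorphic_to_hilbert_space_obtains_form by blast
  show "stampacchia_property TYPE('a)"
    unfolding stampacchia_property_def
  proof (intro exI[of _ p] conjI allI impI p(1))
    fix M :: "'a set" and x' :: "'a \<Rightarrow>\<^sub>L real"
    assume "M \<noteq> {} \<and> closed M \<and> convex M"
    then show "\<exists>!x. x \<in> M \<and> (\<forall>z\<in>M. p x (z - x) \<ge> x' (z - x))"
      by (intro symmetric_coercive_variational_inequality[OF p]) simp_all
  qed
next
  assume "stampacchia_property TYPE('a)"
  then obtain a :: "'a \<Rightarrow> 'a \<Rightarrow> real" where bil: "bounded_bilinear a"
    and sol: "\<And>(M :: 'a set) (x' :: 'a \<Rightarrow>\<^sub>L real). M \<noteq> {} \<and> closed M \<and> convex M \<Longrightarrow>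
      \<exists>!x. x \<in> M \<and> (\<forall>z\<in>M. a x (z - x) \<ge> x' (z - x))"
    unfolding stampacchia_property_def by auto
  have "stampacchia_form a"
    by (intro stampacchia_form.intro stampacchia_form_axioms.intro bil sol conjI)
  then show "isomorphic_to_hilbert_space TYPE('a)"
    by (intro coercive_form_imp_isomorphic_to_hilbert_space[OF bil] stampacchia_form.coercive)
qed

end
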